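(* Suppose that all stations in a network of $N$ stations employ the decentralised L-MAC protocol with schedule length $C$ and learning strength $\beta$. Assuming that the number of stations $N$ is not more than $C$, for any $\beta\in(0,1)$ the network converges in finite time to a collision-free schedule with probability one.
   Context: Stations share a wireless channel, without hidden nodes (every station hears every other), and transmission failures are due to collisions. Time on the medium is divided into MAC-level slots: each slot is idle (no station transmits), a successful transmission (exactly one station transmits) or a collision (two or more stations transmit). A slot is busy if it is not idle. Each station uses a periodic schedule of $C$ consecutive slots, which it labels $1,\ldots,C$, and selects one slot in each schedule. Stations need not agree on the labelling of the slots, i.e. on where a schedule begins and ends; two stations' selected slots are regarded as the same when they refer to the same position on the medium modulo the period $C$, and as distinct otherwise. A station that has a packet to send transmits in its selected slot; a station that has no packet to send does not transmit but still observes the medium during its selected slot. No assumption is made that stations always have packets to send. The L-MAC protocol with learning strength $\beta$ is the following randomised rule, run by each station using its own random choices. The station maintains a probability vector $\mathbf{p}(n)=[p_1(n),\ldots,p_C(n)]$ on $\{1,\ldots,C\}$. 1. At time $0$ the vector is initialised to the uniform distribution, $\mathbf{p}(0)=[1/C,\ldots,1/C]$, and a slot $s(0)$ is randomly selected in $\{1,\ldots,C\}$ according to the probabilities $\mathbf{p}(0)$. 2. Let $s(n)$ denote the slot selected by the station in the $n$'th schedule. The probabilities are updated as follows. Success: if the station has a packet to send and is successful, or if it has no packet to send and observes the medium to be idle during slot $s(n)$, then $p_{s(n)}(n+1)=1$ and $p_j(n+1)=0$ for all $j\neq s(n)$, $j\in\{1,\ldots,C\}$. Failure: if transmitting in slot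 $s(n)$ results in a collision, or if the station has no packet to send and observes the medium to be busy during slot $s(n)$, then $p_{s(n)}(n+1)=\beta p_{s(n)}(n)$ and $p_j(n+1)=\beta p_j(n)+\frac{1-\beta}{C-1}$ for all $j\neq s(n)$, $j\in\{1,\ldots,C\}$. The station then randomly selects a new slot $s(n+1)$ in the next schedule using the probabilities $\mathbf{p}(n+1)$ (equivalently, a backoff counter of $C-s(n)+s(n+1)$ slots). 3. Return to step 2. A collision-free schedule is an allocation in which the selected slots of all $N$ stations are pairwise distinct. Convergence in finite time to a collision-free schedule means that there is a finite (random) time from which the stations' selected slots are pairwise distinct and each station keeps its selected slot in all later schedules.
   Formalization: The formal theorem additionally assumes that, with probability one, at most one station has packets to send in only finitely many schedules; otherwise two stations that never send again could share an idle slot forever and the claim fails. *)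

theory Defs
  imports "HOL-Probability.Probability"
begin

text \<open>
  Medium slots are numbered \<open>0, 1, 2, \<dots>\<close>. The labelling of station \<open>i\<close> is shifted by an offset
  \<open>d i < C\<close>: label \<open>l \<in> {1..C}\<close> of its schedule number \<open>n\<close> is the medium slot
  \<open>d i + n * C + (l - 1)\<close>.

  The first group of definitions concerns a single sample path: \<open>x i n\<close> is the label selected by
  station \<open>i < N\<close> in its schedule \<open>n\<close>, and \<open>a i n\<close> says whether it has a packet to send when that
  selected slot occurs.
\<close>

definition slot_time :: "nat \<Rightarrow> nat \<Rightarrow> nat \<Rightarrow> nat \<Rightarrow> nat" where
  "slot_time C d n l = d + n * C + (l - 1)"

datatype slot_state = Idle | Successful | Collision

definition transmitters ::
  "nat \<Rightarrow> nat \<Rightarrow> (nat \<Rightarrow> nat) \<Rightarrow> (nat \<Rightarrow> nat \<Rightarrow> nat) \<Rightarrow> (nat \<Rightarrow> nat \<Rightarrow> bool) \<Rightarrow> nat \<Rightarrow> nat set" where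
  "transmitters N C d x a t = {i. i < N \<and> (\<exists>n. slot_time C (d i) n (x i n) = t \<and> a i n)}"

definition slot_state_at ::
  "nat \<Rightarrow> nat \<Rightarrow> (nat \<Rightarrow> nat) \<Rightarrow> (nat \<Rightarrow> nat \<Rightarrow> nat) \<Rightarrow> (nat \<Rightarrow> nat \<Rightarrow> bool) \<Rightarrow> nat \<Rightarrow> slot_state" where
  "slot_state_at N C d x a t =
    (if card (transmitters N C d x a t) = 0 then Idle
     else if card (transmitters N C d x a t) = 1 then Successful
     else Collision)"

definition lmac_success ::
  "nat \<Rightarrow> nat \<Rightarrow> (nat \<Rightarrow> nat) \<Rightarrow> (nat \<Rightarrow> nat \<Rightarrow> nat) \<Rightarrow> (nat \<Rightarrow> nat \<Rightarrow> bool) \<Rightarrow> nat \<Rightarrow> nat \<Rightarrow> bool" where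
  "lmac_success N C d x a i n =
    (let st = slot_state_at N C d x a (slot_time C (d i) n (x i n))
     in if a i n then st = Successful else st = Idle)"

text \<open>
  The probability vector of one station, as a function of its own selected labels \<open>y\<close> and
  successes \<open>succ\<close>: \<open>lmac_prob C \<beta> y succ n j\<close> is $p_j(n)$.
\<close>

primrec lmac_prob ::
  "nat \<Rightarrow> real \<Rightarrow> (nat \<Rightarrow> nat) \<Rightarrow> (nat \<Rightarrow> bool) \<Rightarrow> nat \<Rightarrow> nat \<Rightarrow> real" where
  "lmac_prob C \<beta> y succ 0 j = 1 / real C"
| "lmac_prob C \<beta> y succ (Suc n) j =
    (if succ n then (if j = y n then 1 else 0)
     else if j = y n then \<beta> * lmac_prob C \<beta> y succ n j
     else \<beta> * lmac_prob C \<beta> y succ n j + (1 - \<beta>) / (real C - 1))"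

text \<open>
  \<open>sched_index C (d i) t\<close> is the schedule of station \<open>i\<close> containing the medium slot \<open>t\<close>
  (for \<open>t \<ge> d i\<close>; for \<open>t < d i\<close> it is \<open>0\<close> and \<open>in_slot\<close> is false).
\<close>

definition sched_index :: "nat \<Rightarrow> nat \<Rightarrow> nat \<Rightarrow> nat" where
  "sched_index C d t = (t - d) div C"

definition in_slot :: "nat \<Rightarrow> nat \<Rightarrow> (nat \<Rightarrow> nat) \<Rightarrow> nat \<Rightarrow> bool" where
  "in_slot C d y t \<longleftrightarrow> slot_time C d (sched_index C d t) (y (sched_index C d t)) = t"

definition collision_free ::
  "nat \<Rightarrow> nat \<Rightarrow> (nat \<Rightarrow> nat) \<Rightarrow> (nat \<Rightarrow> nat \<Rightarrow> nat) \<Rightarrow> nat \<Rightarrow> bool" where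
  "collision_free N C d x n \<longleftrightarrow> inj_on (\<lambda>i. slot_time C (d i) n (x i n) mod C) {..<N}"

definition converges_collision_free ::
  "nat \<Rightarrow> nat \<Rightarrow> (nat \<Rightarrow> nat) \<Rightarrow> (nat \<Rightarrow> nat \<Rightarrow> nat) \<Rightarrow> bool" where
  "converges_collision_free N C d x \<longleftrightarrow>
    (\<exists>T. \<forall>n\<ge>T. collision_free N C d x n \<and> (\<forall>i<N. x i n = x i T))"

text \<open>
  A network of \<open>N\<close> stations running L-MAC. The random variables are \<open>s i n\<close> (selected labels) and
  \<open>pkt i n\<close> (packet available in the selected slot). The sigma-algebra \<open>F t\<close> contains what is
  determined once medium slot \<open>t\<close> has taken place, except the selections that stations whose
  selected slot is \<open>t\<close> make in response to it; those belong to \<open>F (Suc t)\<close>.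

  The packet process is only required to be non-anticipating. It may be random and may depend on
  the entire past (for instance through queues that are emptied by successful transmissions).

  \<open>select_next\<close> is the selection rule: given the past, the stations whose selected slot is \<open>t\<close>
  choose their next labels independently of each other, each according to its updated vector. The
  product is \<open>1\<close> if there are no such stations.
\<close>

locale lmac_network =
  prob_space M + filtration "space M" F
  for M :: "'w measure" and F :: "nat \<Rightarrow> 'w measure" +
  fixes N C :: nat
    and \<beta> :: real
    and d :: "nat \<Rightarrow> nat"
    and s :: "nat \<Rightarrow> nat \<Rightarrow> 'w \<Rightarrow> nat"
    and pkt :: "nat \<Rightarrow> nat \<Rightarrow> 'w \<Rightarrow> bool"
  assumes subalg: "\<And>t. subalgebra M (F t)"
    and offset: "\<And>i. i < N \<Longrightarrow> d i < C"
    and label: "\<And>i n \<omega>. i < N \<Longrightarrow> \<omega> \<in> space M \<Longrightarrow> s i n \<omega> \<in> {1..C}"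
    and adapted_init: "\<And>i l. i < N \<Longrightarrow> {\<omega> \<in> space M. s i 0 \<omega> = l} \<in> sets (F 0)"
    and adapted_next: "\<And>i t l. i < N \<Longrightarrow>
      {\<omega> \<in> space M. in_slot C (d i) (\<lambda>n. s i n \<omega>) t \<and> s i (Suc (sched_index C (d i) t)) \<omega> = l}
        \<in> sets (F (Suc t))"
    and adapted_pkt: "\<And>i t. i < N \<Longrightarrow>
      {\<omega> \<in> space M. in_slot C (d i) (\<lambda>n. s i n \<omega>) t \<and> pkt i (sched_index C (d i) t) \<omega>}
        \<in> sets (F t)"
    and select_init: "\<And>m. (\<And>i. i < N \<Longrightarrow> m i \<in> {1..C}) \<Longrightarrow>
      prob {\<omega> \<in> space M. \<forall>i<N. s i 0 \<omega> = m i} = (\<Prod>i<N. 1 / real C)"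
    and select_next: "\<And>t m. (\<And>i. i < N \<Longrightarrow> m i \<in> {1..C}) \<Longrightarrow>
      AE \<omega> in M.
        real_cond_exp M (F t)
          (indicator {\<omega>' \<in> space M. \<forall>i<N. in_slot C (d i) (\<lambda>n. s i n \<omega>') t \<longrightarrow>
             s i (Suc (sched_index C (d i) t)) \<omega>' = m i}) \<omega>
        = (\<Prod>i | i < N \<and> in_slot C (d i) (\<lambda>n. s i n \<omega>) t.
             lmac_prob C \<beta> (\<lambda>n. s i n \<omega>)
               (lmac_success N C d (\<lambda>k n. s k n \<omega>) (\<lambda>k n. pkt k n \<omega>) i)
               (Suc (sched_index C (d i) t)) (m i))"

text \<open>
  Two stations that never have packets again and share a slot both observe it idle and both keep
  it for ever, so their selected slots stay equal. The following condition on a path of the packet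
  process excludes exactly this: at most one station has packets in only finitely many of its
  schedules. It does not require any station to always have packets.
\<close>

definition at_most_one_eventually_silent :: "nat \<Rightarrow> (nat \<Rightarrow> nat \<Rightarrow> bool) \<Rightarrow> bool" where
  "at_most_one_eventually_silent N a \<longleftrightarrow>
    (\<forall>i<N. \<forall>j<N. finite {n. a i n} \<and> finite {n. a j n} \<longrightarrow> i = j)"

end

theory Submission
  imports Defs
begin

text \<open>
  A station that succeeds keeps its slot almost surely, so only medium slots with a failing
  station matter. Let \<open>k\<close> be the number of distinct slots (modulo \<open>C\<close>) currently held, and let
  \<open>R\<close> be the number of stations whose held slot had weight at least
  \<open>\<delta> = (1 - \<beta>) / (C - 1)\<close> when it was selected. At a failure two stations share a slot,
  so some slot \<open>e\<close> is free. If one of the colliding stations succeeds or is counted in \<open>R\<close>, let it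
  stay and send the others to \<open>e\<close>: \<open>k\<close> grows. Otherwise send all of them to \<open>e\<close>: \<open>k\<close> does not
  drop and \<open>R\<close> grows. Every single choice made here has weight at least \<open>\<beta> * \<delta>\<close>, so each failure
  increases \<open>\<Phi> = k * (N + 1) + R\<close> with conditional probability at least \<open>(\<beta> * \<delta>) ^ N\<close>, and
  \<open>\<Phi>\<close> never decreases in the absence of failures. As \<open>\<Phi>\<close> is bounded, a bounded function of it
  has drift at least the failure probability; hence these probabilities are summable, and by
  Borel--Cantelli there are finitely many failures. After the last failure nobody moves, and two
  stations sharing a slot could then never send again.
\<close>

section \<open>Drift of a bounded potential\<close>

text \<open>A finite family cuts the space into finitely many atoms, and the set in question is a
  union of some of them. This replaces separate measurability proofs for quantities with complicated
  recursive definitions.\<close>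

lemma (in sigma_algebra) sets_Collect_determined:
  assumes "finite \<A>" "\<A> \<subseteq> M"
    and "\<And>\<omega> \<omega>'. \<omega> \<in> \<Omega> \<Longrightarrow> \<omega>' \<in> \<Omega> \<Longrightarrow> (\<And>A. A \<in> \<A> \<Longrightarrow> \<omega> \<in> A \<longleftrightarrow> \<omega>' \<in> A) \<Longrightarrow> Q \<omega> \<Longrightarrow> Q \<omega>'"
  shows "{\<omega> \<in> \<Omega>. Q \<omega>} \<in> M"
proof -
  define S where "S = (\<lambda>\<omega>. {A \<in> \<A>. \<omega> \<in> A})"
  have "{\<omega> \<in> \<Omega>. Q \<omega>} = {\<omega> \<in> \<Omega>. \<exists>B\<in>S ` {\<omega> \<in> \<Omega>. Q \<omega>}. \<forall>A\<in>\<A>. \<omega> \<in> A \<longleftrightarrow> A \<in> B}"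
    using assms(3) unfolding S_def by (auto; blast)
  also have "\<dots> \<in> M"
  proof (intro sets_Collect_finite_Ex sets_Collect_finite_All)
    show "finite (S ` {\<omega> \<in> \<Omega>. Q \<omega>})"
      by (rule finite_subset[of _ "Pow \<A>"]) (use assms(1) in \<open>auto simp: S_def\<close>)
    fix A B assume "A \<in> \<A>"
    then have "A \<in> M" "A \<subseteq> \<Omega>" using assms(2) sets_into_space by auto
    then have "{\<omega> \<in> \<Omega>. \<omega> \<in> A \<longleftrightarrow> A \<in> B} = (if A \<in> B then A else \<Omega> - A)" by auto
    then show "{\<omega> \<in> \<Omega>. \<omega> \<in> A \<longleftrightarrow> A \<in> B} \<in> M" using \<open>A \<in> M\<close> by auto
  qed (use assms in auto)
  finally show ?thesis .
qed

text \<open>Hypothesis \<open>up\<close> is a conditional bound written with plain probabilities on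
  the level sets of \<open>\<Phi> t\<close>, so no filtration enters here. On \<open>f t\<close> the
  process may also drop arbitrarily far.\<close>

lemma (in prob_space) drift_finitely_often:
  fixes \<Phi> :: "nat \<Rightarrow> 'a \<Rightarrow> nat" and f :: "nat \<Rightarrow> 'a set"
  assumes meas[measurable]: "\<And>t. \<Phi> t \<in> measurable M (count_space UNIV)" "\<And>t. f t \<in> events"
    and bound: "\<And>t \<omega>. \<omega> \<in> space M \<Longrightarrow> \<Phi> t \<omega> \<le> K"
    and mono: "\<And>t. AE \<omega> in M. \<omega> \<notin> f t \<longrightarrow> \<Phi> t \<omega> \<le> \<Phi> (Suc t) \<omega>"
    and \<epsilon>: "0 < \<epsilon>"
    and up: "\<And>t k. \<epsilon> * prob {\<omega> \<in> space M. \<omega> \<in> f t \<and> \<Phi> t \<omega> = k}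
                \<le> prob {\<omega> \<in> space M. \<omega> \<in> f t \<and> \<Phi> t \<omega> = k \<and> k < \<Phi> (Suc t) \<omega>}"
  shows "AE \<omega> in M. finite {t. \<omega> \<in> f t}"
proof -
  define V :: "nat \<Rightarrow> real" where "V k = (\<Sum>j=1..k. (1 / \<epsilon>) ^ j)" for k
  have V0: "0 \<le> V k" for k unfolding V_def by (rule sum_nonneg) (use \<epsilon> in auto)
  have Vmono: "V k \<le> V l" if "k \<le> l" for k l
    unfolding V_def by (rule sum_mono2) (use \<epsilon> that in auto)
  \<comment> \<open>\<open>V\<close> solves \<open>\<epsilon> * V (k + 1) + (1 - \<epsilon>) * V 0 = V k + 1\<close>: even if a step that is not
    an increase falls back to \<open>0\<close>, \<open>V\<close> gains \<open>1\<close> on average.\<close>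
  have VSuc: "\<epsilon> * V (Suc k) = V k + 1" for k
    by (induction k) (use \<epsilon> in \<open>auto simp: V_def field_simps\<close>)
  have int: "integrable M (\<lambda>\<omega>. V (\<Phi> t \<omega>))" for t
    by (rule integrable_const_bound[where B = "V K"])
       (use V0 Vmono bound in \<open>auto intro!: AE_I2\<close>)
  define A where "A t k = {\<omega> \<in> space M. \<omega> \<in> f t \<and> \<Phi> t \<omega> = k}" for t k
  define B where "B t k = {\<omega> \<in> space M. \<omega> \<in> f t \<and> \<Phi> t \<omega> = k \<and> k < \<Phi> (Suc t) \<omega>}" for t k
  have Am[measurable]: "A t k \<in> events" and Bm[measurable]: "B t k \<in> events" for t k
    unfolding A_def B_def by measurable
  have intn: "integrable M (\<lambda>\<omega>. indicator (space M - f t) \<omega> * V (\<Phi> t \<omega>))" for t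
    using integrable_mult_indicator[OF _ int, of "space M - f t" t] by simp
  have ind: "integrable M (indicat_real X)" if "X \<in> events" for X
    using that by (simp add: emeasure_eq_measure)
  have sums: "integrable M (\<lambda>\<omega>. \<Sum>k\<le>K. c k * indicat_real (X k) \<omega>)"
    "(\<integral>\<omega>. (\<Sum>k\<le>K. c k * indicat_real (X k) \<omega>) \<partial>M) = (\<Sum>k\<le>K. c k * prob (X k))"
    if X: "\<And>k. X k \<in> events" for c :: "nat \<Rightarrow> real" and X
  proof -
    have *: "integrable M (\<lambda>\<omega>. c k * indicat_real (X k) \<omega>)" for k
      by (intro integrable_mult_right ind X)
    show "integrable M (\<lambda>\<omega>. \<Sum>k\<le>K. c k * indicat_real (X k) \<omega>)"
      by (intro Bochner_Integration.integrable_sum *)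
    show "(\<integral>\<omega>. (\<Sum>k\<le>K. c k * indicat_real (X k) \<omega>) \<partial>M) = (\<Sum>k\<le>K. c k * prob (X k))"
      by (subst Bochner_Integration.integral_sum[OF *]) (simp add: X)
  qed
  have step: "(\<integral>\<omega>. V (\<Phi> t \<omega>) \<partial>M) + prob (f t) \<le> (\<integral>\<omega>. V (\<Phi> (Suc t) \<omega>) \<partial>M)" for t
  proof -
    \<comment> \<open>On \<open>f t\<close> the integrand is split by the value of
      \<open>\<Phi> t\<close>, so that \<open>up\<close> can be applied level by level.\<close>
    have eq: "V (\<Phi> t \<omega>) + indicator (f t) \<omega> =
        indicator (space M - f t) \<omega> * V (\<Phi> t \<omega>) + (\<Sum>k\<le>K. (V k + 1) * indicator (A t k) \<omega>)"
      if "\<omega> \<in> space M" for \<omega>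
    proof -
      have "(\<Sum>k\<le>K. (V k + 1) * indicator (A t k) \<omega>) =
            (\<Sum>k\<le>K. if k = \<Phi> t \<omega> then (V k + 1) * indicator (f t) \<omega> else 0)"
        by (rule sum.cong) (use that in \<open>auto simp: A_def indicator_def\<close>)
      also have "\<dots> = (V (\<Phi> t \<omega>) + 1) * indicator (f t) \<omega>"
        using bound[OF that, of t] by simp
      finally show ?thesis using that by (auto simp: indicator_def)
    qed
    \<comment> \<open>On \<open>f t\<close>, outcomes without an increase are estimated by
      \<open>0\<close>, and an increase from level \<open>k\<close> is credited only with
      \<open>V (Suc k)\<close>.\<close>
    have le: "AE \<omega> in M. indicator (space M - f t) \<omega> * V (\<Phi> t \<omega>) + (\<Sum>k\<le>K. V (Suc k) * indicator (B t k) \<omega>)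
        \<le> V (\<Phi> (Suc t) \<omega>)"
      using mono[of t]
    proof eventually_elim
      fix \<omega> assume *: "\<omega> \<notin> f t \<longrightarrow> \<Phi> t \<omega> \<le> \<Phi> (Suc t) \<omega>"
      have "(\<Sum>k\<le>K. V (Suc k) * indicator (B t k) \<omega>) \<le>
            (\<Sum>k\<le>K. if k = \<Phi> t \<omega> then V (\<Phi> (Suc t) \<omega>) * indicator (f t) \<omega> else 0)"
        by (rule sum_mono) (use V0 Vmono in \<open>auto simp: B_def indicator_def\<close>)
      also have "\<dots> \<le> V (\<Phi> (Suc t) \<omega>) * indicator (f t) \<omega>"
        using V0 by simp
      finally show "indicator (space M - f t) \<omega> * V (\<Phi> t \<omega>) + (\<Sum>k\<le>K. V (Suc k) * indicator (B t k) \<omega>)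
          \<le> V (\<Phi> (Suc t) \<omega>)"
        using * V0[of "\<Phi> (Suc t) \<omega>"] Vmono[of "\<Phi> t \<omega>" "\<Phi> (Suc t) \<omega>"]
        by (cases "\<omega> \<in> f t") (auto simp: indicator_def split: if_splits)
    qed
    have "(\<integral>\<omega>. V (\<Phi> t \<omega>) \<partial>M) + prob (f t) = (\<integral>\<omega>. V (\<Phi> t \<omega>) + indicator (f t) \<omega> \<partial>M)"
      using int ind meas(2) by (subst Bochner_Integration.integral_add) auto
    also have "\<dots> = (\<integral>\<omega>. indicator (space M - f t) \<omega> * V (\<Phi> t \<omega>) + (\<Sum>k\<le>K. (V k + 1) * indicator (A t k) \<omega>) \<partial>M)"
      by (rule Bochner_Integration.integral_cong[OF refl]) (rule eq)
    also have "\<dots> = (\<integral>\<omega>. indicator (space M - f t) \<omega> * V (\<Phi> t \<omega>) \<partial>M) + (\<Sum>k\<le>K. (V k + 1) * prob (A t k))"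
      by (subst Bochner_Integration.integral_add[OF intn sums(1)[OF Am]]) (simp only: sums(2)[OF Am])
    also have "\<dots> \<le> (\<integral>\<omega>. indicator (space M - f t) \<omega> * V (\<Phi> t \<omega>) \<partial>M) + (\<Sum>k\<le>K. V (Suc k) * prob (B t k))"
    proof (intro add_left_mono sum_mono)
      fix k
      have "(V k + 1) * prob (A t k) = V (Suc k) * (\<epsilon> * prob (A t k))"
        unfolding VSuc[symmetric] by simp
      also have "\<dots> \<le> V (Suc k) * prob (B t k)"
        using up[of t k] V0 unfolding A_def B_def by (intro mult_left_mono) auto
      finally show "(V k + 1) * prob (A t k) \<le> V (Suc k) * prob (B t k)" .
    qed
    also have "\<dots> = (\<integral>\<omega>. indicator (space M - f t) \<omega> * V (\<Phi> t \<omega>) + (\<Sum>k\<le>K. V (Suc k) * indicator (B t k) \<omega>) \<partial>M)"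
      by (subst Bochner_Integration.integral_add[OF intn sums(1)[OF Bm]]) (simp only: sums(2)[OF Bm])
    also have "\<dots> \<le> (\<integral>\<omega>. V (\<Phi> (Suc t) \<omega>) \<partial>M)"
      using intn int le sums(1)[OF Bm] by (intro integral_mono_AE Bochner_Integration.integrable_add)
    finally show ?thesis .
  qed
  have "(\<Sum>t<n. prob (f t)) + (\<integral>\<omega>. V (\<Phi> 0 \<omega>) \<partial>M) \<le> (\<integral>\<omega>. V (\<Phi> n \<omega>) \<partial>M)" for n
  proof (induction n)
    case (Suc n) then show ?case using step[of n] by simp
  qed simp
  moreover have "(\<integral>\<omega>. V (\<Phi> n \<omega>) \<partial>M) \<le> V K" for n
    by (rule integral_le_const[OF int]) (use Vmono bound in \<open>auto intro!: AE_I2\<close>)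
  moreover have "0 \<le> (\<integral>\<omega>. V (\<Phi> 0 \<omega>) \<partial>M)" using V0 by simp
  ultimately have "(\<Sum>t<n. prob (f t)) \<le> V K" for n
    by (smt (verit))
  then have "summable (\<lambda>t. prob (f t))"
    by (intro summableI_nonneg_bounded[where x = "V K"]) auto
  then have "AE \<omega> in M. eventually (\<lambda>t. \<omega> \<in> space M - f t) sequentially"
    by (intro borel_cantelli_AE1) (auto simp: emeasure_eq_measure)
  then show ?thesis
  proof eventually_elim
    fix \<omega> assume "\<forall>\<^sub>F t in sequentially. \<omega> \<in> space M - f t"
    then show "finite {t. \<omega> \<in> f t}"
      by (auto simp: cofinite_eq_sequentially[symmetric] eventually_cofinite elim!: finite_subset[rotated])
  qed
qed

section \<open>Sample paths\<close>

locale lmac_setting =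
  fixes N C :: nat and d :: "nat \<Rightarrow> nat" and \<beta> :: real
  assumes offset: "\<And>i. i < N \<Longrightarrow> d i < C"
    and N_le_C: "N \<le> C"
    and \<beta>_pos: "0 < \<beta>" and \<beta>_less: "\<beta> < 1"
begin

definition valid :: "(nat \<Rightarrow> nat \<Rightarrow> nat) \<Rightarrow> bool" where
  "valid x \<longleftrightarrow> (\<forall>i<N. \<forall>n. x i n \<in> {1..C})"

definition stime :: "(nat \<Rightarrow> nat \<Rightarrow> nat) \<Rightarrow> nat \<Rightarrow> nat \<Rightarrow> nat" where
  "stime x i n = slot_time C (d i) n (x i n)"

text \<open>
  \<open>pending x t i\<close> is the schedule of the next selected slot of station \<open>i\<close> at or after \<open>t\<close>. It may
  be one more than \<open>sched_index C (d i) t\<close>, when station \<open>i\<close> has already made its next choice.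
\<close>

definition pending :: "(nat \<Rightarrow> nat \<Rightarrow> nat) \<Rightarrow> nat \<Rightarrow> nat \<Rightarrow> nat" where
  "pending x t i = (LEAST n. t \<le> stime x i n)"

definition active :: "(nat \<Rightarrow> nat \<Rightarrow> nat) \<Rightarrow> nat \<Rightarrow> nat set" where
  "active x t = {i. i < N \<and> stime x i (pending x t i) = t}"

definition label_phase :: "nat \<Rightarrow> nat \<Rightarrow> nat" where
  "label_phase i l = (d i + (l - 1)) mod C"

definition phase :: "(nat \<Rightarrow> nat \<Rightarrow> nat) \<Rightarrow> nat \<Rightarrow> nat \<Rightarrow> nat" where
  "phase x t i = label_phase i (x i (pending x t i))"

abbreviation succeeds where
  "succeeds x a i n \<equiv> lmac_success N C d x a i n"

abbreviation weight where
  "weight x a i n j \<equiv> lmac_prob C \<beta> (x i) (succeeds x a i) n j"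

definition failure :: "(nat \<Rightarrow> nat \<Rightarrow> nat) \<Rightarrow> (nat \<Rightarrow> nat \<Rightarrow> bool) \<Rightarrow> nat \<Rightarrow> bool" where
  "failure x a t \<longleftrightarrow> (\<exists>i\<in>active x t. \<not> succeeds x a i (pending x t i))"

text \<open>The amount added at a failure to every label except the one just tried, hence a lower
  bound for the weight of any other label. For \<open>C = 1\<close> division by zero makes it
  \<open>0\<close>.\<close>

definition \<delta> :: real where "\<delta> = (1 - \<beta>) / (real C - 1)"

text \<open>A failure multiplies the weight of the held label by \<open>\<beta>\<close>, so a
  station in this set that fails still has weight at least \<open>\<beta> * \<delta>\<close> on
  staying where it is.\<close>

definition robust :: "(nat \<Rightarrow> nat \<Rightarrow> nat) \<Rightarrow> (nat \<Rightarrow> nat \<Rightarrow> bool) \<Rightarrow> nat \<Rightarrow> nat set" where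
  "robust x a t = {i. i < N \<and> \<delta> \<le> weight x a i (pending x t i) (x i (pending x t i))}"

text \<open>A lexicographic order coded as one number: the second summand is at most
  \<open>N\<close>, so one more occupied slot outweighs any loss in it.\<close>

definition potential :: "(nat \<Rightarrow> nat \<Rightarrow> nat) \<Rightarrow> (nat \<Rightarrow> nat \<Rightarrow> bool) \<Rightarrow> nat \<Rightarrow> nat" where
  "potential x a t = card (phase x t ` {..<N}) * (N + 1) + card (robust x a t)"

definition next_phase where
  "next_phase x t m i = (if i \<in> active x t then label_phase i (m i) else phase x t i)"

text \<open>A sufficient condition for a choice \<open>m\<close> to raise the potential with each
  factor of its probability bounded below. It refers to the path only through what is known before
  the selections made in response to slot \<open>t\<close>, so a target can be fixed in
  advance.\<close>

definition good_target ::
  "(nat \<Rightarrow> nat \<Rightarrow> nat) \<Rightarrow> (nat \<Rightarrow> nat \<Rightarrow> bool) \<Rightarrow> nat \<Rightarrow> (nat \<Rightarrow> nat) \<Rightarrow> bool" where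
  "good_target x a t m \<longleftrightarrow>
    (\<forall>i\<in>active x t. \<beta> * \<delta> \<le> weight x a i (Suc (pending x t i)) (m i)) \<and>
    (card (phase x t ` {..<N}) < card (next_phase x t m ` {..<N}) \<or>
     card (phase x t ` {..<N}) \<le> card (next_phase x t m ` {..<N}) \<and> active x t \<noteq> {} \<and>
     (\<forall>i\<in>active x t. m i \<noteq> x i (pending x t i) \<and> \<not> succeeds x a i (pending x t i) \<and> i \<notin> robust x a t))"

section \<open>Timing of the selected slots\<close>

lemma validD: "valid x \<Longrightarrow> i < N \<Longrightarrow> 1 \<le> x i n \<and> x i n \<le> C"
  unfolding valid_def by auto

lemma stime_bounds:
  assumes "valid x" "i < N"
  shows "d i + n * C \<le> stime x i n" "stime x i n < d i + Suc n * C"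
  using validD[OF assms, of n] unfolding stime_def slot_time_def by auto

lemma stime_mono:
  assumes "valid x" "i < N" "n < n'"
  shows "stime x i n < stime x i n'"
proof -
  have "Suc n * C \<le> n' * C" using assms(3) by (intro mult_right_mono) auto
  then show ?thesis using stime_bounds[OF assms(1,2), of n] stime_bounds[OF assms(1,2), of n'] by linarith
qed

lemma stime_less_iff: "valid x \<Longrightarrow> i < N \<Longrightarrow> stime x i n < stime x i n' \<longleftrightarrow> n < n'"
  using stime_mono by (metis linorder_neqE_nat order_less_asym order_less_irrefl)

lemma stime_ge:
  assumes "valid x" "i < N" shows "n \<le> stime x i n"
proof -
  have "n * 1 \<le> n * C" using offset[OF assms(2)] by (intro mult_left_mono) auto
  then show ?thesis using stime_bounds[OF assms, of n] by linarith
qed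

text \<open>Since \<open>n \<le> stime x i n\<close>, the index \<open>t\<close> witnesses the
  \<open>LEAST\<close>; strict monotonicity of \<open>stime\<close> gives the rest. The later facts
  about \<open>pending\<close> are derived from this equivalence.\<close>

lemma pending_le_iff: "valid x \<Longrightarrow> i < N \<Longrightarrow> pending x t i \<le> n \<longleftrightarrow> t \<le> stime x i n"
proof -
  assume v: "valid x" "i < N"
  have "t \<le> stime x i (pending x t i)"
    unfolding pending_def by (rule LeastI[of _ t]) (rule stime_ge[OF v])
  moreover have "pending x t i \<le> n" if "t \<le> stime x i n"
    unfolding pending_def by (rule Least_le) fact
  ultimately show ?thesis
    by (meson v stime_less_iff leD leI order_trans order_less_le_trans)
qed

lemma pending_eqI:
  "valid x \<Longrightarrow> i < N \<Longrightarrow> t \<le> stime x i n \<Longrightarrow> (\<And>n'. n' < n \<Longrightarrow> stime x i n' < t) \<Longrightarrow> pending x t i = n"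
  by (meson pending_le_iff antisym leD leI order_refl)

lemma pending_stime [simp]: "valid x \<Longrightarrow> i < N \<Longrightarrow> pending x (stime x i n) i = n"
  by (rule pending_eqI) (auto simp: stime_less_iff)

lemma active_iff: "valid x \<Longrightarrow> i \<in> active x t \<longleftrightarrow> i < N \<and> (\<exists>n. stime x i n = t)"
  unfolding active_def by auto

lemma activeD: "i \<in> active x t \<Longrightarrow> i < N" "i \<in> active x t \<Longrightarrow> stime x i (pending x t i) = t"
  unfolding active_def by auto

lemma finite_active [simp]: "finite (active x t)" unfolding active_def by auto

lemma pending_Suc:
  assumes "valid x" "i < N"
  shows "pending x (Suc t) i = (if i \<in> active x t then Suc (pending x t i) else pending x t i)"
proof (rule pending_eqI[OF assms])
  let ?p = "pending x t i"
  have t: "t \<le> stime x i ?p" using pending_le_iff[OF assms, of t ?p] by simp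
  have lt: "stime x i n < t" if "n < ?p" for n
    using that pending_le_iff[OF assms, of t n] by linarith
  show "Suc t \<le> stime x i (if i \<in> active x t then Suc ?p else ?p)"
    using t stime_mono[OF assms, of ?p "Suc ?p"] assms(2) by (auto simp: active_def)
  show "stime x i n' < Suc t" if "n' < (if i \<in> active x t then Suc ?p else ?p)" for n'
    using that lt[of n'] activeD(2)[of i x t] by (auto split: if_splits simp: less_Suc_eq)
qed

lemma sched_index_stime:
  assumes "valid x" "i < N" shows "sched_index C (d i) (stime x i n) = n"
proof -
  have "(stime x i n - d i) div C = n"
  proof (rule div_nat_eqI)
    show "C * n \<le> stime x i n - d i" using stime_bounds[OF assms, of n] by (simp add: mult.commute)
    show "stime x i n - d i < C * Suc n" using stime_bounds[OF assms, of n] by (simp add: mult.commute)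
  qed
  then show ?thesis unfolding sched_index_def .
qed

text \<open>Bridge to the vocabulary of \<open>lmac_network\<close>: a selected slot at time
  \<open>t\<close> can only belong to the schedule \<open>sched_index C (d i) t\<close>, so testing
  that one schedule loses nothing.\<close>

lemma in_slot_iff: "valid x \<Longrightarrow> i < N \<Longrightarrow> in_slot C (d i) (x i) t \<longleftrightarrow> i \<in> active x t"
  unfolding in_slot_def active_iff stime_def[symmetric]
  by (metis sched_index_stime)

lemma sched_index_active: "valid x \<Longrightarrow> i \<in> active x t \<Longrightarrow> sched_index C (d i) t = pending x t i"
  by (metis activeD sched_index_stime)

lemma stime_mod: "stime x i n mod C = label_phase i (x i n)"
  unfolding stime_def slot_time_def label_phase_def
  by (metis add.commute add.left_commute mod_mult_self2 mult.commute)

lemma phase_active: "i \<in> active x t \<Longrightarrow> phase x t i = t mod C"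
  using stime_mod[of x i "pending x t i"] activeD(2)[of i x t] unfolding phase_def by simp

lemma label_phase_surj:
  assumes "i < N" "q < C" shows "\<exists>l\<in>{1..C}. label_phase i l = q"
proof (cases "d i \<le> q")
  case True
  then show ?thesis using assms by (intro bexI[of _ "q - d i + 1"]) (auto simp: label_phase_def)
next
  case False
  then show ?thesis using assms offset[of i]
    by (intro bexI[of _ "C + q - d i + 1"]) (auto simp: label_phase_def)
qed

section \<open>Outcome of a slot and selection weights\<close>

lemma transmitters_eq: "valid x \<Longrightarrow> transmitters N C d x a t = {i \<in> active x t. a i (pending x t i)}"
  unfolding transmitters_def stime_def[symmetric] by (auto simp: active_iff)

lemma finite_transmitters [simp]: "finite (transmitters N C d x a t)"
  unfolding transmitters_def by auto

text \<open>The slot state only records a cardinality, but a sending station is itself a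
  transmitter, so cardinality one identifies the whole set.\<close>

lemma succeeds_iff:
  assumes "valid x" "i \<in> active x t"
  shows "succeeds x a i (pending x t i) \<longleftrightarrow>
    (if a i (pending x t i) then transmitters N C d x a t = {i} else transmitters N C d x a t = {})"
proof -
  have "slot_time C (d i) (pending x t i) (x i (pending x t i)) = t"
    using activeD(2)[OF assms(2)] unfolding stime_def .
  moreover have "a i (pending x t i) \<Longrightarrow> i \<in> transmitters N C d x a t"
    using assms by (simp add: transmitters_eq)
  ultimately show ?thesis
    unfolding lmac_success_def slot_state_at_def by (auto simp: card_1_singleton_iff)
qed

lemma weight_nonneg: "1 \<le> C \<Longrightarrow> 0 \<le> lmac_prob C \<beta> y sc n j"
  using \<beta>_pos \<beta>_less by (induction n) (auto intro!: add_nonneg_nonneg divide_nonneg_nonneg)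

lemma \<delta>_le_1: "\<delta> \<le> 1"
proof (cases "C \<le> 1")
  \<comment> \<open>Here the denominator is not positive, so the quotient is at most
    \<open>0\<close>, also under division by zero.\<close>
  case True
  then have "real C - 1 \<le> 0" by simp
  then show ?thesis using \<beta>_less unfolding \<delta>_def
    by (metis diff_ge_0_iff_ge divide_nonneg_nonpos less_imp_le order_trans zero_le_one)
next
  case False
  then have "1 \<le> real C - 1" by simp
  then show ?thesis using \<beta>_pos unfolding \<delta>_def by (simp add: divide_le_eq)
qed

lemma weight_move:
  assumes "1 \<le> C" "\<not> succeeds x a i n" "j \<noteq> x i n"
  shows "\<delta> \<le> weight x a i (Suc n) j"
  using assms weight_nonneg[OF assms(1)] \<beta>_pos unfolding \<delta>_def by simp

lemma potential_le: "potential x a t \<le> N * (N + 1) + N"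
proof -
  have "card (phase x t ` {..<N}) \<le> N" using card_image_le[of "{..<N}"] by simp
  moreover have "card (robust x a t) \<le> card {..<N}"
    by (rule card_mono) (auto simp: robust_def)
  ultimately show ?thesis unfolding potential_def by (intro add_mono mult_right_mono) auto
qed

section \<open>Change of the potential in one slot\<close>

lemma phase_Suc_eq:
  assumes "valid x" "i < N"
  shows "phase x (Suc t) i = next_phase x t (\<lambda>i. x i (Suc (pending x t i))) i"
  unfolding next_phase_def phase_def using assms by (simp add: pending_Suc)

lemma robust_Suc_inactive:
  assumes "valid x" "i < N" "i \<notin> active x t"
  shows "i \<in> robust x a (Suc t) \<longleftrightarrow> i \<in> robust x a t"
  unfolding robust_def using assms by (simp add: pending_Suc)

text \<open>If \<open>k\<close> grows, the robust set may shrink freely. Otherwise the active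
  stations were all outside the robust set and have failed and moved; moving after a failure gives
  weight at least \<open>\<delta>\<close>, so they all join it and no member is lost.\<close>

lemma potential_increases:
  assumes v: "valid x" and "good_target x a t m"
    and m: "\<And>i. i \<in> active x t \<Longrightarrow> x i (Suc (pending x t i)) = m i"
  shows "potential x a t < potential x a (Suc t)"
proof -
  let ?k = "card (phase x t ` {..<N})" and ?k' = "card (phase x (Suc t) ` {..<N})"
  have "phase x (Suc t) ` {..<N} = next_phase x t m ` {..<N}"
    by (rule image_cong) (auto simp: phase_Suc_eq[OF v] next_phase_def m)
  then consider "?k < ?k'" | "?k \<le> ?k'" "active x t \<noteq> {}"
    "\<And>i. i \<in> active x t \<Longrightarrow> m i \<noteq> x i (pending x t i) \<and> \<not> succeeds x a i (pending x t i) \<and> i \<notin> robust x a t"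
    using assms(2) by (simp only: good_target_def) blast
  then show ?thesis
  proof cases
    case 1
    have "card (robust x a t) \<le> card {..<N}" by (rule card_mono) (auto simp: robust_def)
    moreover have "Suc ?k * (N + 1) \<le> ?k' * (N + 1)" using 1 by (intro mult_right_mono) auto
    ultimately show ?thesis unfolding potential_def by simp
  next
    case 2
    have "robust x a t \<union> active x t \<subseteq> robust x a (Suc t)"
    proof
      fix i assume i: "i \<in> robust x a t \<union> active x t"
      then have iN: "i < N" by (auto simp: robust_def active_def)
      show "i \<in> robust x a (Suc t)"
      proof (cases "i \<in> active x t")
        case True
        have "\<delta> \<le> weight x a i (Suc (pending x t i)) (m i)"
          by (rule weight_move) (use 2(3)[OF True] offset[OF iN] in auto)
        then show ?thesis using True iN m[OF True] by (simp add: robust_def pending_Suc[OF v])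
      qed (use i in \<open>simp add: robust_Suc_inactive[OF v iN]\<close>)
    qed
    moreover have "robust x a t \<subset> robust x a t \<union> active x t" using 2(2,3) by blast
    ultimately have "robust x a t \<subset> robust x a (Suc t)" by blast
    then have "card (robust x a t) < card (robust x a (Suc t))"
      by (intro psubset_card_mono) (auto simp: robust_def)
    moreover have "?k * (N + 1) \<le> ?k' * (N + 1)" using 2(1) by (intro mult_right_mono) auto
    ultimately show ?thesis unfolding potential_def by simp
  qed
qed

lemma success_stays:
  assumes "succeeds x a i n" "weight x a i (Suc n) (x i (Suc n)) \<noteq> 0"
  shows "x i (Suc n) = x i n"
  using assms by (simp split: if_splits)

text \<open>After a success the vector is a point mass, so a choice of nonzero weight repeats the
  label, now with weight \<open>1\<close>. Assumption \<open>w\<close> excludes exceptional paths on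
  which an impossible label is chosen.\<close>

lemma potential_mono:
  assumes v: "valid x" and "\<not> failure x a t"
    and w: "\<And>i. i \<in> active x t \<Longrightarrow> weight x a i (Suc (pending x t i)) (x i (Suc (pending x t i))) \<noteq> 0"
  shows "potential x a t \<le> potential x a (Suc t)"
proof -
  have sc: "succeeds x a i (pending x t i)" if "i \<in> active x t" for i
    using assms(2) that unfolding failure_def by blast
  have stay: "x i (Suc (pending x t i)) = x i (pending x t i)" if "i \<in> active x t" for i
    using success_stays[OF sc w] that by simp
  have "phase x (Suc t) ` {..<N} = phase x t ` {..<N}"
    by (rule image_cong) (simp_all add: phase_Suc_eq[OF v] next_phase_def, simp add: phase_def stay)
  moreover have "robust x a t \<subseteq> robust x a (Suc t)"
  proof
    fix i assume i: "i \<in> robust x a t"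
    then have iN: "i < N" by (auto simp: robust_def)
    show "i \<in> robust x a (Suc t)"
    proof (cases "i \<in> active x t")
      case True
      then show ?thesis using iN sc[OF True] stay[OF True] \<delta>_le_1
        by (simp add: robust_def pending_Suc[OF v])
    qed (use i in \<open>simp add: robust_Suc_inactive[OF v iN]\<close>)
  qed
  then have "card (robust x a t) \<le> card (robust x a (Suc t))"
    by (intro card_mono) (auto simp: robust_def)
  ultimately show ?thesis unfolding potential_def by simp
qed


section \<open>Favourable choices after a failure\<close>

text \<open>If no other station sent, the failing station would be the sole transmitter or would
  observe an idle slot, and so would succeed. Hence a second active station transmits.\<close>

lemma failure_collision:
  assumes v: "valid x" and f: "failure x a t"
  obtains j k where "j \<in> active x t" "k \<in> active x t" "j \<noteq> k" "transmitters N C d x a t \<noteq> {}"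
proof -
  let ?T = "transmitters N C d x a t"
  obtain i where i: "i \<in> active x t" "\<not> succeeds x a i (pending x t i)"
    using f unfolding failure_def by blast
  have T: "?T \<noteq> {}"
  proof
    assume "?T = {}"
    then show False using i by (auto simp: succeeds_iff[OF v] transmitters_eq[OF v])
  qed
  have "\<exists>k\<in>?T. k \<noteq> i"
  proof (rule ccontr)
    assume "\<not> (\<exists>k\<in>?T. k \<noteq> i)"
    then have "?T = {i}" using T by auto
    then have "a i (pending x t i)" using transmitters_eq[OF v, of a t] by blast
    then show False using i \<open>?T = {i}\<close> by (simp add: succeeds_iff[OF v])
  qed
  then show ?thesis using that i(1) T transmitters_eq[OF v, of a t] by blast
qed

text \<open>Two distinct stations meet and \<open>N \<le> C\<close>. At a failure the denominator
  \<open>C - 1\<close> is therefore positive, and so is \<open>\<delta>\<close>.\<close>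

lemma failure_two_slots:
  assumes "valid x" "failure x a t" shows "2 \<le> C"
proof -
  obtain j k where "j \<in> active x t" "k \<in> active x t" "j \<noteq> k"
    using failure_collision[OF assms] by blast
  then show ?thesis using N_le_C activeD(1)[of j x t] activeD(1)[of k x t] by linarith
qed

lemma \<delta>_pos: "2 \<le> C \<Longrightarrow> 0 < \<delta>"
  unfolding \<delta>_def using \<beta>_less by simp

lemma exists_good_target:
  assumes v: "valid x" and f: "failure x a t"
  shows "\<exists>m\<in>{..<N} \<rightarrow>\<^sub>E {1..C}. good_target x a t m"
proof -
  let ?G = "active x t" and ?T = "transmitters N C d x a t" and ?p = "pending x t"
  let ?Ph = "phase x t ` {..<N}"
  note C2 = failure_two_slots[OF v f]
  obtain g h where gh: "g \<in> ?G" "h \<in> ?G" "g \<noteq> h" and T: "?T \<noteq> {}"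
    using failure_collision[OF v f] by blast
  \<comment> \<open>The stations \<open>g\<close> and \<open>h\<close> share a phase, so dropping
    \<open>h\<close> loses none. At most \<open>N - 1 < C\<close> phases are occupied, and some
    \<open>e\<close> is free.\<close>
  have "?Ph \<subseteq> phase x t ` ({..<N} - {h})"
  proof
    fix q assume "q \<in> ?Ph"
    then obtain i where "i < N" "q = phase x t i" by auto
    then show "q \<in> phase x t ` ({..<N} - {h})"
      using gh activeD(1)[OF gh(1)] phase_active[OF gh(1)] phase_active[OF gh(2)]
      by (cases "i = h") (auto intro!: rev_image_eqI[of g])
  qed
  then have "card ?Ph \<le> card ({..<N} - {h})"
    by (meson card_image_le card_mono finite_Diff finite_imageI finite_lessThan order_trans)
  also have "\<dots> < N" using gh(2) by (use activeD(1)[OF gh(2)] in simp)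
  finally have "card ?Ph < C" using N_le_C by simp
  then have "\<not> {..<C} \<subseteq> ?Ph" using card_mono[of ?Ph "{..<C}"] by auto
  then obtain e where e: "e < C" "e \<notin> ?Ph" by blast
  obtain lab where lab: "\<And>i. i < N \<Longrightarrow> lab i \<in> {1..C} \<and> label_phase i (lab i) = e"
    using label_phase_surj[OF _ e(1)] by metis
  have lab_neq: "lab i \<noteq> x i (?p i)" if "i \<in> ?G" for i
    using lab[of i] e(2) activeD(1)[OF that] unfolding phase_def by auto
  have \<delta>0: "0 \<le> \<delta>" using \<delta>_pos[OF C2] by simp
  have \<beta>\<delta>: "\<beta> * \<delta> \<le> \<delta>" using \<delta>0 \<beta>_less by (simp add: mult_left_le_one_le \<beta>_pos less_imp_le)
  have move: "\<beta> * \<delta> \<le> weight x a i (Suc (?p i)) (lab i)"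
    if "i \<in> ?G" "\<not> succeeds x a i (?p i)" for i
    using weight_move[OF _ that(2) lab_neq[OF that(1)]] C2 \<beta>\<delta> by linarith
  \<comment> \<open>The station \<open>j\<close> that stays is either the successful one, with
    weight \<open>1\<close>, or a failing robust one, with weight at least
    \<open>\<beta> * \<delta>\<close>. Because somebody transmits, at most one active station can
    succeed.\<close>
  consider (stay) j where "j \<in> ?G" "\<beta> * \<delta> \<le> weight x a j (Suc (?p j)) (x j (?p j))"
      "\<And>i. i \<in> ?G \<Longrightarrow> i \<noteq> j \<Longrightarrow> \<not> succeeds x a i (?p i)"
    | (leave) "\<And>i. i \<in> ?G \<Longrightarrow> \<not> succeeds x a i (?p i) \<and> i \<notin> robust x a t"
  proof (cases "\<exists>j\<in>?G. succeeds x a j (?p j)")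
    case True
    then obtain j where j: "j \<in> ?G" "succeeds x a j (?p j)" by blast
    then have "?T = {j}" using T succeeds_iff[OF v j(1)] by (auto split: if_splits)
    then have "\<not> succeeds x a i (?p i)" if "i \<in> ?G" "i \<noteq> j" for i
      using that by (simp add: succeeds_iff[OF v])
    then show ?thesis using j \<beta>\<delta> \<delta>_le_1 by (intro stay[of j]) auto
  next
    case False
    show ?thesis
    proof (cases "\<exists>j\<in>?G. j \<in> robust x a t")
      case True
      then obtain j where j: "j \<in> ?G" "j \<in> robust x a t" by blast
      then have "\<beta> * \<delta> \<le> weight x a j (Suc (?p j)) (x j (?p j))"
        using False \<beta>_pos by (auto simp: robust_def)
      then show ?thesis using j(1) False by (intro stay[of j]) auto
    qed (use False leave in blast)
  qed
  then show ?thesis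
  proof cases
    case stay
    \<comment> \<open>The value \<open>1\<close> for inactive stations is filler that keeps
      \<open>m\<close> in the finite set of candidate choices; \<open>next_phase\<close> ignores
      it.\<close>
    define m where "m = restrict (\<lambda>i. if i \<in> ?G then if i = j then x j (?p j) else lab i else 1) {..<N}"
    have m: "m i = (if i = j then x j (?p j) else lab i)" if "i \<in> ?G" for i
      using that activeD(1)[OF that] by (simp add: m_def)
    have np_j: "next_phase x t m j = t mod C"
      using stay(1) phase_active[OF stay(1)] by (simp add: next_phase_def m phase_def)
    obtain k where k: "k \<in> ?G" "k \<noteq> j" using gh by metis
    \<comment> \<open>Station \<open>j\<close> keeps the contested phase occupied, while
      \<open>k\<close> occupies \<open>e\<close>: nothing is lost and one phase is gained.\<close>
    have "insert e ?Ph \<subseteq> next_phase x t m ` {..<N}"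
    proof -
      have "e = next_phase x t m k"
        using k lab[OF activeD(1)[OF k(1)]] by (simp add: next_phase_def m)
      moreover have "phase x t i \<in> next_phase x t m ` {..<N}" if "i < N" for i
      proof (cases "i \<in> ?G")
        case True
        then show ?thesis using np_j phase_active[OF True] activeD(1)[OF stay(1)] by (metis imageI lessThan_iff)
      next
        case False
        then have "phase x t i = next_phase x t m i" by (simp add: next_phase_def)
        then show ?thesis using that by blast
      qed
      ultimately show ?thesis using activeD(1)[OF k(1)] by auto
    qed
    then have "card (insert e ?Ph) \<le> card (next_phase x t m ` {..<N})" by (intro card_mono) auto
    then have "card ?Ph < card (next_phase x t m ` {..<N})" using e(2) by simp
    moreover have "\<beta> * \<delta> \<le> weight x a i (Suc (?p i)) (m i)" if "i \<in> ?G" for i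
      using m[OF that] move[OF that stay(3)[OF that]] stay(2) by presburger
    moreover have "m \<in> {..<N} \<rightarrow>\<^sub>E {1..C}"
      unfolding m_def using lab validD[OF v] C2 by (auto simp: restrict_PiE_iff)
    ultimately show ?thesis unfolding good_target_def by blast
  next
    case leave
    define m where "m = restrict lab {..<N}"
    have m: "m i = lab i" if "i \<in> ?G" for i
      using activeD(1)[OF that] by (simp add: m_def)
    \<comment> \<open>Only the contested phase can be vacated, and \<open>e\<close> makes up for
      it.\<close>
    have "insert e (?Ph - {t mod C}) \<subseteq> next_phase x t m ` {..<N}"
    proof -
      have "e = next_phase x t m g"
        using gh lab[OF activeD(1)[OF gh(1)]] by (simp add: next_phase_def m)
      moreover have "phase x t i \<in> next_phase x t m ` {..<N}" if "i < N" "phase x t i \<noteq> t mod C" for i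
      proof -
        have "i \<notin> ?G" using that(2) phase_active by blast
        then have "phase x t i = next_phase x t m i" by (simp add: next_phase_def)
        then show ?thesis using that by blast
      qed
      ultimately show ?thesis using activeD(1)[OF gh(1)] by auto
    qed
    then have "card (insert e (?Ph - {t mod C})) \<le> card (next_phase x t m ` {..<N})"
      by (intro card_mono) auto
    moreover have "card ?Ph \<le> card (insert e (?Ph - {t mod C}))"
      using e(2) card_Suc_Diff1[of ?Ph "t mod C"] by (simp add: card_Diff_singleton_if)
    ultimately have "card ?Ph \<le> card (next_phase x t m ` {..<N})" by simp
    moreover have "\<beta> * \<delta> \<le> weight x a i (Suc (?p i)) (m i)" if "i \<in> ?G" for i
      using m[OF that] move[OF that] leave[OF that] by simp
    moreover have "m \<in> {..<N} \<rightarrow>\<^sub>E {1..C}"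
      unfolding m_def using lab by (auto simp: restrict_PiE_iff)
    moreover have "m i \<noteq> x i (?p i) \<and> \<not> succeeds x a i (?p i) \<and> i \<notin> robust x a t" if "i \<in> ?G" for i
      using leave[OF that] lab_neq[OF that] m[OF that] by simp
    moreover have "?G \<noteq> {}" using gh(1) by blast
    ultimately show ?thesis unfolding good_target_def by blast
  qed
qed

text \<open>The number of factors varies with the slot; as
  \<open>\<beta> * \<delta> \<le> 1\<close>, the exponent \<open>N\<close> gives one bound valid for
  all slots.\<close>

lemma good_target_prob:
  assumes "2 \<le> C" "good_target x a t m"
  shows "(\<beta> * \<delta>) ^ N \<le> (\<Prod>i\<in>active x t. weight x a i (Suc (pending x t i)) (m i))"
proof -
  have b: "0 \<le> \<beta> * \<delta>" "\<beta> * \<delta> \<le> 1"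
    using \<delta>_pos[OF assms(1)] \<delta>_le_1 \<beta>_pos \<beta>_less by (auto intro: mult_le_one)
  have "card (active x t) \<le> card {..<N}" by (intro card_mono) (auto simp: active_def)
  then have "(\<beta> * \<delta>) ^ N \<le> (\<beta> * \<delta>) ^ card (active x t)" using b by (intro power_decreasing) auto
  also have "\<dots> = (\<Prod>i\<in>active x t. \<beta> * \<delta>)" by simp
  also have "\<dots> \<le> (\<Prod>i\<in>active x t. weight x a i (Suc (pending x t i)) (m i))"
    using b assms(2) unfolding good_target_def by (intro prod_mono) auto
  finally show ?thesis .
qed


section \<open>Behaviour after the last failure\<close>

text \<open>By counting: the \<open>C\<close> labels are mapped onto all \<open>C\<close>
  residues.\<close>

lemma label_phase_inj:
  assumes "i < N" shows "inj_on (label_phase i) {1..C}"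
proof (rule eq_card_imp_inj_on)
  have "label_phase i ` {1..C} = {..<C}"
    using label_phase_surj[OF assms] offset[OF assms] by (force simp: label_phase_def)
  then show "card (label_phase i ` {1..C}) = card {1..C}" by simp
qed simp

text \<open>A station with a constant label visits every later medium slot of its phase. As
  \<open>d j < C\<close>, a slot from \<open>Suc n0 * C\<close> on lies in a schedule numbered at
  least \<open>n0\<close>, where the label is already constant.\<close>

lemma stime_cover:
  assumes v: "valid x" "j < N" and c: "\<And>n. n0 \<le> n \<Longrightarrow> x j n = x j n0"
    and u: "Suc n0 * C \<le> u" "u mod C = label_phase j (x j n0)"
  obtains n where "n0 \<le> n" "stime x j n = u"
proof
  let ?n = "(u - d j) div C" and ?l = "(u - d j) mod C + 1"
  have C: "0 < C" and dj: "d j < C" using offset[OF v(2)] by auto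
  have "n0 * C \<le> u - d j" using u(1) dj by simp
  then show n: "n0 \<le> ?n" using C by (simp add: less_eq_div_iff_mult_less_eq)
  have "d j + (u - d j) = u" using u(1) dj by simp
  then have "label_phase j ?l = u mod C" unfolding label_phase_def
    by (metis add_diff_cancel_right' mod_add_right_eq)
  then have "label_phase j ?l = label_phase j (x j ?n)" using u(2) c[OF n] by simp
  moreover have "?l \<in> {1..C}" using C by (simp add: Suc_leI)
  moreover have "x j ?n \<in> {1..C}" using validD[OF v, of ?n] by simp
  ultimately have "?l = x j ?n" using label_phase_inj[OF v(2)] by (meson inj_onD)
  then have "x j ?n - 1 = (u - d j) mod C" by simp
  then show "stime x j ?n = u" unfolding stime_def slot_time_def
    using \<open>d j + (u - d j) = u\<close> by simp
qed

lemma converges: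
  assumes v: "valid x" and fin: "finite {t. failure x a t}"
    and w: "\<And>t i. i \<in> active x t \<Longrightarrow> weight x a i (Suc (pending x t i)) (x i (Suc (pending x t i))) \<noteq> 0"
    and silent: "at_most_one_eventually_silent N a"
  shows "converges_collision_free N C d x"
proof -
  obtain T where T: "\<And>t. T \<le> t \<Longrightarrow> \<not> failure x a t"
    using fin by (auto simp: finite_nat_set_iff_bounded not_le[symmetric])
  \<comment> \<open>The medium time \<open>T\<close> also serves as a schedule number, because the
    selected slot of schedule \<open>n\<close> is never earlier than slot \<open>n\<close>.\<close>
  have stay: "x i (Suc n) = x i n" if "T \<le> n" "i < N" for i n
  proof -
    have act: "i \<in> active x (stime x i n)" using that(2) active_iff[OF v] by blast
    have "T \<le> stime x i n" using stime_ge[OF v that(2), of n] that(1) by linarith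
    then have "succeeds x a i n"
      using T act unfolding failure_def by (metis pending_stime[OF v that(2)])
    then show ?thesis by (rule success_stays) (use w[OF act] pending_stime[OF v that(2)] in metis)
  qed
  have const: "x i n = x i T" if "T \<le> n" "i < N" for i n
    using that(1) by (induction rule: dec_induct) (auto simp: stay that(2))
  \<comment> \<open>Station \<open>i\<close> eventually sends in the shared slot. Its success makes
    it the only transmitter, so \<open>j\<close> sees a busy slot or collides, although after
    \<open>T\<close> it must succeed as well.\<close>
  have False
    if ij: "i < N" "j < N" "i \<noteq> j" "label_phase i (x i T) = label_phase j (x j T)"
      and inf: "infinite {n. a i n}" for i j
  proof -
    \<comment> \<open>The extra \<open>1\<close> places the slot at or after
      \<open>Suc T * C\<close>, as \<open>stime_cover\<close> requires.\<close>
    obtain n where n: "T + 1 \<le> n" "a i n" using inf by (auto simp: infinite_nat_iff_unbounded_le)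
    let ?u = "stime x i n"
    have "Suc T * C \<le> n * C" using n(1) by (intro mult_right_mono) auto
    then have "Suc T * C \<le> ?u" using stime_bounds(1)[OF v ij(1), of n] by linarith
    moreover have "?u mod C = label_phase j (x j T)"
      using stime_mod[of x i n] const[of n i] n(1) ij by simp
    ultimately obtain n' where n': "stime x j n' = ?u"
      using stime_cover[OF v ij(2), of T ?u] const ij(2) by metis
    have act: "i \<in> active x ?u" "j \<in> active x ?u"
      using ij n' active_iff[OF v] by blast+
    have "T \<le> ?u" using stime_ge[OF v ij(1), of n] n(1) by linarith
    then have "succeeds x a i (pending x ?u i)" "succeeds x a j (pending x ?u j)"
      using T act unfolding failure_def by blast+
    moreover have "i \<in> transmitters N C d x a ?u"
      using act(1) n(2) ij(1) v by (simp add: transmitters_eq)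
    ultimately show False using ij(3) act by (auto simp: succeeds_iff[OF v] split: if_splits)
  qed
  \<comment> \<open>Of two distinct stations at least one has infinitely many packets; the
    contradiction above is applied with that one as \<open>i\<close>.\<close>
  then have "inj_on (\<lambda>i. label_phase i (x i T)) {..<N}"
    using silent unfolding at_most_one_eventually_silent_def inj_on_def by (metis lessThan_iff)
  then have "collision_free N C d x n" if "T \<le> n" for n
    unfolding collision_free_def stime_def[symmetric] stime_mod
    by (subst inj_on_cong[where g = "\<lambda>i. label_phase i (x i T)"]) (use const[OF that] in auto)
  then show ?thesis unfolding converges_collision_free_def using const by blast
qed

section \<open>Quantities determined by the past\<close>

text \<open>Agreement on the events that the locale places in \<open>F t\<close>: packets up to and
  including slot \<open>t\<close>, but selections made in response to slots strictly before
  \<open>t\<close>. Restricting \<open>l\<close> to \<open>{1..C}\<close> leaves finitely many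
  events.\<close>

definition same_history where
  "same_history t x a x' a' \<longleftrightarrow> (\<forall>i<N.
    x i 0 = x' i 0 \<and>
    (\<forall>u<t. \<forall>l\<in>{1..C}.
      (in_slot C (d i) (x i) u \<and> x i (Suc (sched_index C (d i) u)) = l) \<longleftrightarrow>
      (in_slot C (d i) (x' i) u \<and> x' i (Suc (sched_index C (d i) u)) = l)) \<and>
    (\<forall>u\<le>t.
      (in_slot C (d i) (x i) u \<and> a i (sched_index C (d i) u)) \<longleftrightarrow>
      (in_slot C (d i) (x' i) u \<and> a' i (sched_index C (d i) u))))"

context
  fixes x x' a a' t
  assumes v: "valid x" "valid x'" and same: "same_history t x a x' a'"
begin

text \<open>Each label up to the pending one, apart from the initial label, was chosen in response
  to a slot before \<open>t\<close>. Induction transfers that earlier slot to the other path, where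
  the agreement of the selections then applies.\<close>

lemma select_cong:
  assumes "i < N" shows "n \<le> pending x t i \<Longrightarrow> x i n = x' i n"
proof (induction n)
  case 0
  then show ?case using same assms by (simp add: same_history_def)
next
  case (Suc n)
  then have eq: "x i n = x' i n" by simp
  have "stime x i n < t" using Suc.prems pending_le_iff[OF v(1) assms, of t n] by linarith
  moreover have st: "stime x' i n = stime x i n" by (simp add: stime_def eq)
  moreover have "in_slot C (d i) (x i) (stime x i n)" "in_slot C (d i) (x' i) (stime x i n)"
    using v assms st by (auto simp: in_slot_iff active_iff)
  moreover have "sched_index C (d i) (stime x i n) = n" by (rule sched_index_stime[OF v(1) assms])
  moreover have "x i (Suc n) \<in> {1..C}" using validD[OF v(1) assms] by simp
  ultimately show ?case using same assms unfolding same_history_def by (metis (no_types, lifting))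
qed

lemma stime_cong: "i < N \<Longrightarrow> n \<le> pending x t i \<Longrightarrow> stime x i n = stime x' i n"
  using select_cong by (simp add: stime_def)

lemma pending_cong:
  assumes "i < N" shows "pending x' t i = pending x t i"
proof (rule pending_eqI[OF v(2) assms])
  show "t \<le> stime x' i (pending x t i)"
    using stime_cong[OF assms] pending_le_iff[OF v(1) assms, of t "pending x t i"] by simp
  show "stime x' i n < t" if "n < pending x t i" for n
    using stime_cong[OF assms, of n] pending_le_iff[OF v(1) assms, of t n] that by linarith
qed

lemma le_pending: "valid z \<Longrightarrow> i < N \<Longrightarrow> stime z i n \<le> t \<Longrightarrow> n \<le> pending z t i"
  by (meson pending_le_iff leI le_trans order_refl stime_less_iff leD order_less_le_trans)

lemma active_cong: "active x t = active x' t"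
  unfolding active_def using stime_cong pending_cong by auto

lemma phase_cong: "i < N \<Longrightarrow> phase x t i = phase x' t i"
  unfolding phase_def using select_cong pending_cong by simp

lemma packet_cong:
  assumes "i < N" "stime x i n \<le> t" shows "a i n \<longleftrightarrow> a' i n"
proof -
  have "n \<le> pending x t i" using le_pending[OF v(1)] assms by simp
  then have st: "stime x' i n = stime x i n" using stime_cong[OF assms(1)] by simp
  moreover have "in_slot C (d i) (x i) (stime x i n)" "in_slot C (d i) (x' i) (stime x i n)"
    using v assms(1) st by (auto simp: in_slot_iff active_iff)
  moreover have "sched_index C (d i) (stime x i n) = n" by (rule sched_index_stime[OF v(1) assms(1)])
  ultimately show ?thesis using same assms unfolding same_history_def by (metis (no_types, lifting))
qed

lemma transmitters_cong:
  assumes "u \<le> t" shows "transmitters N C d x a u = transmitters N C d x' a' u"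
proof -
  have "stime x i n = u \<and> a i n \<longleftrightarrow> stime x' i n = u \<and> a' i n" if "i < N" for i n
  proof (cases "n \<le> pending x t i")
    case True
    then show ?thesis using stime_cong[OF that True] packet_cong[OF that] assms by auto
  next
    \<comment> \<open>A schedule beyond the pending one has its slot after \<open>t\<close> on both
      paths, so neither side of the equivalence holds.\<close>
    case False
    then show ?thesis using le_pending[OF v(1) that, of n] le_pending[OF v(2) that, of n]
      pending_cong[OF that] assms by auto
  qed
  then show ?thesis unfolding transmitters_def stime_def[symmetric] by blast
qed

lemma succeeds_cong:
  assumes "i < N" "stime x i n \<le> t" shows "succeeds x a i n \<longleftrightarrow> succeeds x' a' i n"
  using transmitters_cong[OF assms(2)] packet_cong[OF assms] stime_cong[OF assms(1) le_pending[OF v(1) assms]]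
  unfolding lmac_success_def slot_state_at_def stime_def[symmetric] by simp

text \<open>The vector for schedule \<open>n\<close> uses outcomes only up to schedule
  \<open>n - 1\<close>. Hence even the updated vector of a station active at \<open>t\<close> is
  known before it selects again.\<close>

lemma weight_cong:
  assumes "i < N" shows "n = 0 \<or> stime x i (n - 1) \<le> t \<Longrightarrow> weight x a i n j = weight x' a' i n j"
proof (induction n arbitrary: j)
  case (Suc n)
  then have t: "stime x i n \<le> t" by simp
  then have "stime x i (n - 1) \<le> t"
    using stime_less_iff[OF v(1) assms] by (meson diff_le_self le_trans not_le)
  then show ?case
    using Suc.IH succeeds_cong[OF assms t] select_cong[OF assms le_pending[OF v(1) assms t]] by simp
qed simp

lemma weight_pending_cong: "i < N \<Longrightarrow> weight x a i (pending x t i) j = weight x' a' i (pending x t i) j"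
proof (rule weight_cong)
  assume i: "i < N"
  show "pending x t i = 0 \<or> stime x i (pending x t i - 1) \<le> t"
    using pending_le_iff[OF v(1) i, of t "pending x t i - 1"] by linarith
qed

lemma weight_active_cong:
  "i \<in> active x t \<Longrightarrow> weight x a i (Suc (pending x t i)) j = weight x' a' i (Suc (pending x t i)) j"
  by (rule weight_cong) (simp_all add: activeD)

lemma succeeds_active_cong:
  "i \<in> active x t \<Longrightarrow> succeeds x a i (pending x t i) = succeeds x' a' i (pending x' t i)"
  using succeeds_cong[of i "pending x t i"] pending_cong[of i] by (simp add: activeD)

lemma failure_cong: "failure x a t = failure x' a' t"
  unfolding failure_def using succeeds_active_cong active_cong by auto

lemma robust_cong: "robust x a t = robust x' a' t"
  unfolding robust_def using weight_pending_cong pending_cong select_cong by auto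

lemma potential_cong: "potential x a t = potential x' a' t"
proof -
  have "phase x t ` {..<N} = phase x' t ` {..<N}" by (rule image_cong) (auto simp: phase_cong)
  then show ?thesis unfolding potential_def robust_cong by simp
qed

lemma good_target_cong: "good_target x a t m = good_target x' a' t m"
proof -
  have 1: "phase x t ` {..<N} = phase x' t ` {..<N}" by (rule image_cong) (auto simp: phase_cong)
  have 2: "next_phase x t m ` {..<N} = next_phase x' t m ` {..<N}"
    by (rule image_cong) (auto simp: phase_cong next_phase_def active_cong)
  have 3: "weight x a i (Suc (pending x t i)) (m i) = weight x' a' i (Suc (pending x' t i)) (m i)"
    "x i (pending x t i) = x' i (pending x' t i)"
    "succeeds x a i (pending x t i) = succeeds x' a' i (pending x' t i)"
    if "i \<in> active x t" for i
    using weight_active_cong[OF that] pending_cong[OF activeD(1)[OF that]] select_cong[OF activeD(1)[OF that]]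
      succeeds_active_cong[OF that] by auto
  show ?thesis unfolding good_target_def 1 2 robust_cong active_cong[symmetric]
    by (simp only: 3 cong: ball_cong)
qed

lemma product_cong:
  "(\<Prod>i\<in>active x t. weight x a i (Suc (pending x t i)) (m i)) =
   (\<Prod>i\<in>active x' t. weight x' a' i (Suc (pending x' t i)) (m i))"
  unfolding active_cong[symmetric]
proof (rule prod.cong[OF refl])
  fix i assume i: "i \<in> active x t"
  show "weight x a i (Suc (pending x t i)) (m i) = weight x' a' i (Suc (pending x' t i)) (m i)"
    unfolding pending_cong[OF activeD(1)[OF i]] by (rule weight_active_cong[OF i])
qed

end

end

lemma (in finite_measure_subalgebra) measure_Int_eq_cond_exp:
  assumes "S \<in> sets F" "B \<in> sets M"
  shows "measure M (S \<inter> B) = (\<integral>x\<in>S. real_cond_exp M F (indicator B) x \<partial>M)"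
proof -
  have S: "S \<in> sets M" using assms(1) subalg unfolding subalgebra_def by blast
  have "integrable M (indicat_real B)" using assms(2) by (simp add: emeasure_eq_measure)
  then have "(\<integral>x\<in>S. real_cond_exp M F (indicator B) x \<partial>M) = (\<integral>x\<in>S. indicator B x \<partial>M)"
    using real_cond_exp_intA assms(1) by metis
  also have "\<dots> = (\<integral>x. indicat_real (S \<inter> B) x \<partial>M)"
    unfolding set_lebesgue_integral_def by (simp add: indicator_inter_arith)
  also have "\<dots> = measure M (S \<inter> B)" using S assms(2) by simp
  finally show ?thesis ..
qed

section \<open>The random process\<close>

locale lmac_run = lmac_network M F N C \<beta> d s pkt + lmac_setting N C d \<beta>
  for M :: "'w measure" and F N C \<beta> d s pkt
begin

abbreviation labels :: "'w \<Rightarrow> nat \<Rightarrow> nat \<Rightarrow> nat" where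
  "labels \<omega> \<equiv> (\<lambda>i n. s i n \<omega>)"

abbreviation packets :: "'w \<Rightarrow> nat \<Rightarrow> nat \<Rightarrow> bool" where
  "packets \<omega> \<equiv> (\<lambda>i n. pkt i n \<omega>)"

definition fails :: "nat \<Rightarrow> 'w set" where
  "fails t = {\<omega> \<in> space M. failure (labels \<omega>) (packets \<omega>) t}"

definition chooses :: "nat \<Rightarrow> (nat \<Rightarrow> nat) \<Rightarrow> 'w set" where
  "chooses t m = {\<omega> \<in> space M. \<forall>i<N. in_slot C (d i) (\<lambda>n. s i n \<omega>) t \<longrightarrow>
     s i (Suc (sched_index C (d i) t)) \<omega> = m i}"

definition choice_prob :: "nat \<Rightarrow> (nat \<Rightarrow> nat) \<Rightarrow> 'w \<Rightarrow> real" where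
  "choice_prob t m \<omega> = (\<Prod>i\<in>active (labels \<omega>) t.
     weight (labels \<omega>) (packets \<omega>) i (Suc (pending (labels \<omega>) t i)) (m i))"

section \<open>Measurability with respect to the history\<close>

lemma valid_labels [simp]: "\<omega> \<in> space M \<Longrightarrow> valid (labels \<omega>)"
  unfolding valid_def using label by blast

lemma sets_F_le: "t \<le> u \<Longrightarrow> S \<in> sets (F t) \<Longrightarrow> S \<in> sets (F u)"
  using sets_F_mono by blast

lemma sets_F_events: "S \<in> sets (F t) \<Longrightarrow> S \<in> events"
  using subalg[of t] unfolding subalgebra_def by blast

text \<open>The relation \<open>same_history t\<close> is decided by finitely many adapted events,
  so an invariant property is a union of their atoms. The congruence lemmas for sample paths provide
  the invariance.\<close>

lemma history_determined:
  assumes Q: "\<And>\<omega> \<omega>'. \<omega> \<in> space M \<Longrightarrow> \<omega>' \<in> space M \<Longrightarrow>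
    same_history t (labels \<omega>) (packets \<omega>) (labels \<omega>') (packets \<omega>') \<Longrightarrow> Q \<omega> \<Longrightarrow> Q \<omega>'"
  shows "{\<omega> \<in> space M. Q \<omega>} \<in> sets (F t)"
proof -
  interpret Ft: sigma_algebra "space M" "sets (F t)"
    using sets.sigma_algebra_axioms[of "F t"] by (simp add: space_F)
  define H1 where "H1 i l = {\<omega> \<in> space M. s i 0 \<omega> = l}" for i l
  define H2 where "H2 i u l = {\<omega> \<in> space M. in_slot C (d i) (\<lambda>n. s i n \<omega>) u \<and>
    s i (Suc (sched_index C (d i) u)) \<omega> = l}" for i u l
  define H3 where "H3 i u = {\<omega> \<in> space M. in_slot C (d i) (\<lambda>n. s i n \<omega>) u \<and>
    pkt i (sched_index C (d i) u) \<omega>}" for i u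
  define \<A> where "\<A> = (\<Union>i<N. H1 i ` {1..C} \<union> (\<Union>u<t. H2 i u ` {1..C}) \<union> H3 i ` {..t})"
  have "{\<omega> \<in> space M. Q \<omega>} \<in> sets (F t)"
  proof (rule Ft.sets_Collect_determined)
    show "finite \<A>" by (simp add: \<A>_def)
    have "H1 i l \<in> sets (F t)" if "i < N" for i l
      using sets_F_le[OF _ adapted_init[OF that]] by (simp add: H1_def)
    moreover have "H2 i u l \<in> sets (F t)" if "i < N" "u < t" for i u l
      using sets_F_le[OF _ adapted_next[OF that(1)], of u t] that(2) by (simp add: H2_def)
    moreover have "H3 i u \<in> sets (F t)" if "i < N" "u \<le> t" for i u
      using sets_F_le[OF _ adapted_pkt[OF that(1)], of u t] that(2) by (simp add: H3_def)
    ultimately show "\<A> \<subseteq> sets (F t)" by (auto simp: \<A>_def)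
  next
    fix \<omega> \<omega>' assume w: "\<omega> \<in> space M" "\<omega>' \<in> space M" and A: "\<And>A. A \<in> \<A> \<Longrightarrow> \<omega> \<in> A \<longleftrightarrow> \<omega>' \<in> A"
      and "Q \<omega>"
    have "s i 0 \<omega> = s i 0 \<omega>'" if "i < N" for i
    proof -
      have "H1 i (s i 0 \<omega>) \<in> \<A>" using that label[OF that w(1), of 0] unfolding \<A>_def by blast
      from A[OF this] show ?thesis using w by (simp add: H1_def)
    qed
    moreover have "in_slot C (d i) (\<lambda>n. s i n \<omega>) u \<and> s i (Suc (sched_index C (d i) u)) \<omega> = l \<longleftrightarrow>
        in_slot C (d i) (\<lambda>n. s i n \<omega>') u \<and> s i (Suc (sched_index C (d i) u)) \<omega>' = l"
      if "i < N" "u < t" "l \<in> {1..C}" for i u l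
    proof -
      have "H2 i u l \<in> \<A>" using that unfolding \<A>_def by blast
      from A[OF this] show ?thesis using w by (simp add: H2_def)
    qed
    moreover have "in_slot C (d i) (\<lambda>n. s i n \<omega>) u \<and> pkt i (sched_index C (d i) u) \<omega> \<longleftrightarrow>
        in_slot C (d i) (\<lambda>n. s i n \<omega>') u \<and> pkt i (sched_index C (d i) u) \<omega>'"
      if "i < N" "u \<le> t" for i u
    proof -
      have "H3 i u \<in> \<A>" using that unfolding \<A>_def by blast
      from A[OF this] show ?thesis using w by (simp add: H3_def)
    qed
    ultimately have "same_history t (labels \<omega>) (packets \<omega>) (labels \<omega>') (packets \<omega>')"
      unfolding same_history_def by blast
    then show "Q \<omega>'" using Q w \<open>Q \<omega>\<close> by blast
  qed
  then show ?thesis .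
qed

lemma fails_sets: "fails t \<in> events"
  unfolding fails_def
  by (rule sets_F_events, rule history_determined[of t]) (simp add: failure_cong[OF valid_labels valid_labels])

lemma potential_sets: "{\<omega> \<in> space M. potential (labels \<omega>) (packets \<omega>) t = k} \<in> events"
  by (rule sets_F_events, rule history_determined[of t]) (simp add: potential_cong[OF valid_labels valid_labels])

lemma potential_measurable:
  "(\<lambda>\<omega>. potential (labels \<omega>) (packets \<omega>) t) \<in> measurable M (count_space UNIV)"
proof (subst measurable_count_space_eq_countable, simp, intro conjI ballI)
  show "(\<lambda>\<omega>. potential (labels \<omega>) (packets \<omega>) t) \<in> space M \<rightarrow> UNIV" by simp
  fix k
  have "(\<lambda>\<omega>. potential (labels \<omega>) (packets \<omega>) t) -` {k} \<inter> space M =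
    {\<omega> \<in> space M. potential (labels \<omega>) (packets \<omega>) t = k}" by auto
  then show "(\<lambda>\<omega>. potential (labels \<omega>) (packets \<omega>) t) -` {k} \<inter> space M \<in> events"
    using potential_sets by simp
qed

text \<open>The selections answering slot \<open>t\<close> enter the filtration only at
  \<open>Suc t\<close>, hence the longer history.\<close>

lemma chooses_sets: "chooses t m \<in> events"
  unfolding chooses_def
proof (rule sets_F_events, rule history_determined[of "Suc t"], intro allI impI)
  fix \<omega> \<omega>' i
  assume w: "\<omega> \<in> space M" "\<omega>' \<in> space M" and i: "i < N"
    and h: "same_history (Suc t) (labels \<omega>) (packets \<omega>) (labels \<omega>') (packets \<omega>')"
    and c: "\<forall>i<N. in_slot C (d i) (\<lambda>n. s i n \<omega>) t \<longrightarrow> s i (Suc (sched_index C (d i) t)) \<omega> = m i"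
    and sl: "in_slot C (d i) (\<lambda>n. s i n \<omega>') t"
  let ?l = "s i (Suc (sched_index C (d i) t)) \<omega>'"
  have "?l \<in> {1..C}" by (rule label[OF i w(2)])
  then have "in_slot C (d i) (\<lambda>n. s i n \<omega>) t \<and> s i (Suc (sched_index C (d i) t)) \<omega> = ?l"
    using h i sl unfolding same_history_def by (metis lessI)
  then show "?l = m i" using c i by metis
qed

section \<open>Probabilities of the selections\<close>

lemma chooses_iff:
  assumes "\<omega> \<in> space M"
  shows "\<omega> \<in> chooses t m \<longleftrightarrow>
    (\<forall>i\<in>active (labels \<omega>) t. labels \<omega> i (Suc (pending (labels \<omega>) t i)) = m i)"
  using assms in_slot_iff[OF valid_labels[OF assms]] sched_index_active[OF valid_labels[OF assms]]
  unfolding chooses_def by (auto simp: activeD(1))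

lemma cond_exp_chooses:
  assumes "m \<in> {..<N} \<rightarrow>\<^sub>E {1..C}"
  shows "AE \<omega> in M. real_cond_exp M (F t) (indicator (chooses t m)) \<omega> = choice_prob t m \<omega>"
proof -
  have eq: "choice_prob t m \<omega> = (\<Prod>i | i < N \<and> in_slot C (d i) (\<lambda>n. s i n \<omega>) t.
      lmac_prob C \<beta> (\<lambda>n. s i n \<omega>)
        (lmac_success N C d (\<lambda>k n. s k n \<omega>) (\<lambda>k n. pkt k n \<omega>) i)
        (Suc (sched_index C (d i) t)) (m i))" if "\<omega> \<in> space M" for \<omega>
    unfolding choice_prob_def
  proof (rule prod.cong)
    show "active (labels \<omega>) t = {i. i < N \<and> in_slot C (d i) (\<lambda>n. s i n \<omega>) t}"
      using in_slot_iff[OF valid_labels[OF that]] activeD(1) by blast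
    fix i assume i: "i \<in> {i. i < N \<and> in_slot C (d i) (\<lambda>n. s i n \<omega>) t}"
    then have "i \<in> active (labels \<omega>) t" using in_slot_iff[OF valid_labels[OF that]] by blast
    then show "weight (labels \<omega>) (packets \<omega>) i (Suc (pending (labels \<omega>) t i)) (m i) =
        weight (labels \<omega>) (packets \<omega>) i (Suc (sched_index C (d i) t)) (m i)"
      by (simp only: sched_index_active[OF valid_labels[OF that]])
  qed
  have mi: "m i \<in> {1..C}" if "i < N" for i
    using PiE_mem[OF assms] that by blast
  have "AE \<omega> in M. real_cond_exp M (F t) (indicator (chooses t m)) \<omega> =
    (\<Prod>i | i < N \<and> in_slot C (d i) (\<lambda>n. s i n \<omega>) t.
      lmac_prob C \<beta> (\<lambda>n. s i n \<omega>)
        (lmac_success N C d (\<lambda>k n. s k n \<omega>) (\<lambda>k n. pkt k n \<omega>) i)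
        (Suc (sched_index C (d i) t)) (m i))"
    using select_next[of m t, OF mi] unfolding chooses_def .
  then show ?thesis using AE_space by eventually_elim (simp only: eq)
qed

text \<open>Integrates the conditional selection probability over an event of the past. The lower
  bound serves the favourable choices, the zero case excludes choices of weight zero.\<close>

lemma prob_chooses:
  assumes S: "S \<in> sets (F t)" and m: "m \<in> {..<N} \<rightarrow>\<^sub>E {1..C}"
  shows prob_chooses_ge: "(\<And>\<omega>. \<omega> \<in> S \<Longrightarrow> e \<le> choice_prob t m \<omega>) \<Longrightarrow> e * prob S \<le> prob (S \<inter> chooses t m)"
    and prob_chooses_0: "(\<And>\<omega>. \<omega> \<in> S \<Longrightarrow> choice_prob t m \<omega> = 0) \<Longrightarrow> prob (S \<inter> chooses t m) = 0"
proof -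
  interpret G: finite_measure_subalgebra M "F t"
    by unfold_locales (rule subalg)
  let ?f = "real_cond_exp M (F t) (indicator (chooses t m))"
  have SM: "S \<in> events" by (rule sets_F_events[OF S])
  have eq: "prob (S \<inter> chooses t m) = (\<integral>x\<in>S. ?f x \<partial>M)"
    by (rule G.measure_Int_eq_cond_exp[OF S chooses_sets])
  have int: "integrable M (\<lambda>x. indicator S x * ?f x)"
  proof -
    have "integrable M (indicat_real (chooses t m))"
      using chooses_sets by (simp add: emeasure_eq_measure)
    from integrable_mult_indicator[OF SM G.real_cond_exp_int(1)[OF this]] show ?thesis by simp
  qed
  have int': "integrable M (\<lambda>x. e * indicat_real S x)"
    using SM by (intro integrable_mult_right) (simp add: emeasure_eq_measure)
  show "e * prob S \<le> prob (S \<inter> chooses t m)" if "\<And>\<omega>. \<omega> \<in> S \<Longrightarrow> e \<le> choice_prob t m \<omega>"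
  proof -
    have "e * prob S = (\<integral>x. e * indicat_real S x \<partial>M)" using SM by simp
    also have "\<dots> \<le> (\<integral>x. indicator S x * ?f x \<partial>M)"
    proof (rule integral_mono_AE[OF int' int])
      show "AE x in M. e * indicat_real S x \<le> indicator S x * ?f x"
        using cond_exp_chooses[OF m, of t] by eventually_elim (use that in \<open>auto simp: indicator_def\<close>)
    qed
    finally show ?thesis unfolding eq set_lebesgue_integral_def by simp
  qed
  show "prob (S \<inter> chooses t m) = 0" if "\<And>\<omega>. \<omega> \<in> S \<Longrightarrow> choice_prob t m \<omega> = 0"
  proof -
    have "AE x in M. indicator S x * ?f x = 0"
      using cond_exp_chooses[OF m, of t] by eventually_elim (use that in \<open>auto simp: indicator_def\<close>)
    then have "(\<integral>x. indicator S x * ?f x \<partial>M) = 0" by (rule integral_eq_zero_AE)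
    then show ?thesis unfolding eq set_lebesgue_integral_def by simp
  qed
qed

text \<open>For fixed \<open>t\<close> and \<open>m\<close>, making the choice \<open>m\<close> when
  its conditional probability is \<open>0\<close> is a null event. There are countably many
  \<open>t\<close> and finitely many \<open>m\<close>, so the union is null too.\<close>

lemma AE_selected_weight_nonzero:
  "AE \<omega> in M. \<forall>t. \<forall>i\<in>active (labels \<omega>) t.
    weight (labels \<omega>) (packets \<omega>) i (Suc (pending (labels \<omega>) t i))
      (labels \<omega> i (Suc (pending (labels \<omega>) t i))) \<noteq> 0"
proof -
  let ?P = "{..<N} \<rightarrow>\<^sub>E {1..C}"
  define Z where "Z t m = {\<omega> \<in> space M. choice_prob t m \<omega> = 0}" for t m
  have Z: "Z t m \<in> sets (F t)" for t m
    unfolding Z_def choice_prob_def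
    by (rule history_determined) (simp only: product_cong[OF valid_labels valid_labels])
  have "AE \<omega> in M. \<omega> \<notin> Z t m \<inter> chooses t m" if "m \<in> ?P" for t m
  proof (rule AE_not_in, rule null_setsI)
    show "Z t m \<inter> chooses t m \<in> events" using sets_F_events[OF Z] chooses_sets by blast
    show "emeasure M (Z t m \<inter> chooses t m) = 0"
      using prob_chooses_0[OF Z that, of t] by (simp add: emeasure_eq_measure Z_def)
  qed
  then have "AE \<omega> in M. \<forall>t. \<forall>m\<in>?P. \<omega> \<notin> Z t m \<inter> chooses t m"
    unfolding AE_all_countable by (intro allI AE_finite_allI) (auto intro!: finite_PiE)
  then show ?thesis using AE_space
  proof eventually_elim
    fix \<omega> assume nz: "\<forall>t. \<forall>m\<in>?P. \<omega> \<notin> Z t m \<inter> chooses t m" and w: "\<omega> \<in> space M"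
    show "\<forall>t. \<forall>i\<in>active (labels \<omega>) t.
      weight (labels \<omega>) (packets \<omega>) i (Suc (pending (labels \<omega>) t i))
        (labels \<omega> i (Suc (pending (labels \<omega>) t i))) \<noteq> 0"
    proof (intro allI ballI)
      fix t i assume i: "i \<in> active (labels \<omega>) t"
      \<comment> \<open>The choice actually made, restricted so that it is one of the finitely many
        candidates.\<close>
      define m where "m = restrict (\<lambda>i. labels \<omega> i (Suc (pending (labels \<omega>) t i))) {..<N}"
      have "m \<in> ?P" using label[OF _ w] by (auto simp: m_def restrict_PiE_iff)
      moreover have "\<omega> \<in> chooses t m"
        unfolding chooses_iff[OF w] by (simp add: m_def activeD(1))
      ultimately have "choice_prob t m \<omega> \<noteq> 0" using nz w by (auto simp: Z_def)
      then have "weight (labels \<omega>) (packets \<omega>) i (Suc (pending (labels \<omega>) t i)) (m i) \<noteq> 0"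
        using i unfolding choice_prob_def prod_zero_iff[OF finite_active] by blast
      then show "weight (labels \<omega>) (packets \<omega>) i (Suc (pending (labels \<omega>) t i))
        (labels \<omega> i (Suc (pending (labels \<omega>) t i))) \<noteq> 0"
        using activeD(1)[OF i] by (simp only: m_def restrict_apply lessThan_iff if_True not_False_eq_True)
    qed
  qed
qed

text \<open>The favourable choice varies with the path but is determined by the past. Splitting the
  failure event by its value gives disjoint pieces in \<open>F t\<close>, on each of which one fixed
  choice \<open>m\<close> has the required conditional probability.\<close>

lemma prob_potential_increases:
  assumes "2 \<le> C"
  shows "(\<beta> * \<delta>) ^ N * prob {\<omega> \<in> space M. \<omega> \<in> fails t \<and> potential (labels \<omega>) (packets \<omega>) t = k} \<le>
    prob {\<omega> \<in> space M. \<omega> \<in> fails t \<and> potential (labels \<omega>) (packets \<omega>) t = k \<and>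
      k < potential (labels \<omega>) (packets \<omega>) (Suc t)}" (is "?e * prob ?S \<le> prob ?R")
proof -
  let ?P = "{..<N} \<rightarrow>\<^sub>E {1..C}"
  define target where "target \<omega> = (SOME m. m \<in> ?P \<and> good_target (labels \<omega>) (packets \<omega>) t m)" for \<omega>
  define S where "S m = {\<omega> \<in> space M. failure (labels \<omega>) (packets \<omega>) t \<and>
    potential (labels \<omega>) (packets \<omega>) t = k \<and> target \<omega> = m}" for m
  have target: "target \<omega> \<in> ?P \<and> good_target (labels \<omega>) (packets \<omega>) t (target \<omega>)"
    if "\<omega> \<in> fails t" for \<omega>
  proof -
    have "\<omega> \<in> space M" "failure (labels \<omega>) (packets \<omega>) t" using that by (simp_all add: fails_def)
    from exists_good_target[OF valid_labels[OF this(1)] this(2)]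
    have "\<exists>m. m \<in> ?P \<and> good_target (labels \<omega>) (packets \<omega>) t m" by (simp only: Bex_def)
    from someI_ex[OF this] show ?thesis unfolding target_def .
  qed
  have S: "S m \<in> sets (F t)" for m
    unfolding S_def
  proof (rule history_determined)
    fix \<omega> \<omega>' assume w: "\<omega> \<in> space M" "\<omega>' \<in> space M"
      and h: "same_history t (labels \<omega>) (packets \<omega>) (labels \<omega>') (packets \<omega>')"
      and Q: "failure (labels \<omega>) (packets \<omega>) t \<and> potential (labels \<omega>) (packets \<omega>) t = k \<and> target \<omega> = m"
    note v = valid_labels[OF w(1)] valid_labels[OF w(2)]
    \<comment> \<open>Paths with the same history have equal predicates \<open>good_target\<close>,
      so \<open>SOME\<close> returns the same choice for both.\<close>
    have "target \<omega> = target \<omega>'"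
      unfolding target_def good_target_cong[OF v h] ..
    then show "failure (labels \<omega>') (packets \<omega>') t \<and> potential (labels \<omega>') (packets \<omega>') t = k \<and> target \<omega>' = m"
      using Q failure_cong[OF v h] potential_cong[OF v h] by simp
  qed
  have finP: "finite ?P" by (intro finite_PiE) auto
  have R: "?R \<in> events"
  proof -
    note [measurable] = potential_measurable fails_sets
    show ?thesis by measurable
  qed
  have SD: "\<omega> \<in> S m \<longleftrightarrow> \<omega> \<in> ?S \<and> target \<omega> = m" for \<omega> m
    by (simp add: S_def fails_def conj_assoc)
  have US: "?S = (\<Union>m\<in>?P. S m)"
  proof (intro equalityI subsetI)
    fix \<omega> assume w: "\<omega> \<in> ?S"
    then have "target \<omega> \<in> ?P" using target[of \<omega>] by simp
    then show "\<omega> \<in> (\<Union>m\<in>?P. S m)" by (rule UN_I) (simp only: SD w simp_thms)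
  qed (simp only: UN_iff SD, blast)
  have disj: "S m \<inter> S m' = {}" if "m \<noteq> m'" for m m'
  proof (rule ccontr)
    assume "S m \<inter> S m' \<noteq> {}"
    then obtain \<omega> where "\<omega> \<in> S m" "\<omega> \<in> S m'" by blast
    then have "target \<omega> = m" "target \<omega> = m'" by (simp_all only: SD)
    then show False using that by simp
  qed
  then have "disjoint_family_on S ?P" unfolding disjoint_family_on_def by blast
  moreover have "S ` ?P \<subseteq> events" using sets_F_events[OF S] by blast
  ultimately have "prob ?S = (\<Sum>m\<in>?P. prob (S m))"
    unfolding US by (intro finite_measure_finite_Union finP)
  then have "?e * prob ?S = (\<Sum>m\<in>?P. ?e * prob (S m))" by (simp add: sum_distrib_left)
  also have "\<dots> \<le> (\<Sum>m\<in>?P. prob (S m \<inter> chooses t m))"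
  proof (rule sum_mono)
    fix m assume m: "m \<in> ?P"
    show "?e * prob (S m) \<le> prob (S m \<inter> chooses t m)"
    proof (rule prob_chooses_ge[OF S m])
      fix \<omega> assume "\<omega> \<in> S m"
      then have "good_target (labels \<omega>) (packets \<omega>) t m" using target[of \<omega>] SD by simp
      then show "?e \<le> choice_prob t m \<omega>" unfolding choice_prob_def by (rule good_target_prob[OF assms])
    qed
  qed
  also have "\<dots> = prob (\<Union>m\<in>?P. S m \<inter> chooses t m)"
  proof (rule finite_measure_finite_Union[OF finP, symmetric])
    show "(\<lambda>m. S m \<inter> chooses t m) ` ?P \<subseteq> events" using sets_F_events[OF S] chooses_sets by blast
    show "disjoint_family_on (\<lambda>m. S m \<inter> chooses t m) ?P" unfolding disjoint_family_on_def using disj by blast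
  qed
  also have "\<dots> \<le> prob ?R"
  proof (rule finite_measure_mono[OF _ R], rule UN_least, rule subsetI)
    fix m \<omega> assume "m \<in> ?P" and *: "\<omega> \<in> S m \<inter> chooses t m"
    then have w: "\<omega> \<in> ?S" "target \<omega> = m" by (simp_all only: SD Int_iff)
    then have sp: "\<omega> \<in> space M" and gt: "good_target (labels \<omega>) (packets \<omega>) t m"
      using target[of \<omega>] by simp_all
    have "\<omega> \<in> chooses t m" using * by simp
    then have "potential (labels \<omega>) (packets \<omega>) t < potential (labels \<omega>) (packets \<omega>) (Suc t)"
      unfolding chooses_iff[OF sp] by (intro potential_increases[OF valid_labels[OF sp] gt]) (rule bspec)
    then show "\<omega> \<in> ?R" using w(1) by simp
  qed
  finally show ?thesis .
qed

lemma AE_finitely_many_failures: "AE \<omega> in M. finite {t. \<omega> \<in> fails t}"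
proof (cases "2 \<le> C")
  case True
  show ?thesis
  proof (rule drift_finitely_often[OF potential_measurable fails_sets potential_le])
    show "AE \<omega> in M. \<omega> \<notin> fails t \<longrightarrow>
      potential (labels \<omega>) (packets \<omega>) t \<le> potential (labels \<omega>) (packets \<omega>) (Suc t)" for t
      using AE_selected_weight_nonzero AE_space
      by eventually_elim (auto simp: fails_def intro!: potential_mono)
    show "0 < (\<beta> * \<delta>) ^ N" using \<beta>_pos \<delta>_pos[OF True] by simp
  qed (rule prob_potential_increases[OF True])
next
  case False
  then have "fails t = {}" for t
    using failure_two_slots[OF valid_labels] unfolding fails_def by blast
  then show ?thesis by simp
qed

lemma AE_converges:
  assumes "AE \<omega> in M. at_most_one_eventually_silent N (packets \<omega>)"
  shows "AE \<omega> in M. converges_collision_free N C d (labels \<omega>)"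
  using assms AE_finitely_many_failures AE_selected_weight_nonzero AE_space
proof eventually_elim
  case (elim \<omega>)
  then have "finite {t. failure (labels \<omega>) (packets \<omega>) t}" by (simp add: fails_def)
  then show ?case
    using elim by (intro converges[where a = "packets \<omega>"]) (simp_all only: valid_labels not_False_eq_True)
qed

end

theorem theorem2:
  fixes M :: "'w measure" and F :: "nat \<Rightarrow> 'w measure"
    and N C :: nat and \<beta> :: real and d :: "nat \<Rightarrow> nat"
    and s :: "nat \<Rightarrow> nat \<Rightarrow> 'w \<Rightarrow> nat" and pkt :: "nat \<Rightarrow> nat \<Rightarrow> 'w \<Rightarrow> bool"
  assumes "lmac_network M F N C \<beta> d s pkt"
    and "0 < \<beta>" and "\<beta> < 1"
    and "N \<le> C"
    and "AE \<omega> in M. at_most_one_eventually_silent N (\<lambda>i n. pkt i n \<omega>)"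
  shows "AE \<omega> in M. converges_collision_free N C d (\<lambda>i n. s i n \<omega>)"
proof -
  interpret lmac_network M F N C \<beta> d s pkt by fact
  interpret lmac_run M F N C \<beta> d s pkt
    by unfold_locales (use assms(2-4) offset in auto)
  show ?thesis by (rule AE_converges[OF assms(5)])
qed

end
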